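(* Let $H,G$ be Hilbert spaces, let $\mathcal{A}:H\to G$ be a boundedly invertible linear operator, let $F\subset G$ be a linear subspace equipped with a quasi-norm $\|\cdot\|_F$, and let $S:F\to H$ be the restriction of $\mathcal{A}^{-1}$ to $F$. Let $C\ge 1$ and $n\in\mathbb{N}$. Then $$ e_{n,C}^{\mathrm{non}}(S,F,H)\;\ge\;\frac{1}{2C}\,b_m(S,F,H)$$ holds for all $m\in\mathbb{N}$ with $m\ge 4C^2n$.
   Context: Spaces are real. A sequence $\mathcal{B}=\{h_i\mid i\in\mathbb{N}\}\subset H$ is a Riesz basis of $H$ if there are constants $A,B>0$ such that for all scalar sequences $(\alpha_k)$ with only finitely many nonzero entries $$A\Big(\sum_k|\alpha_k|^2\Big)^{1/2}\le\Big\|\sum_k\alpha_kh_k\Big\|_H\le B\Big(\sum_k|\alpha_k|^2\Big)^{1/2},$$ and the finite sums $\sum\alpha_kh_k$ are dense in $H$. $A$ and $B$ always denote the optimal constants of $\mathcal{B}$. For $C\ge1$, $\mathcal{B}_C$ is the set of all Riesz bases $\mathcal{B}$ of $H$ with $B/A\le C$. For a mapping $S_n:F\to H$ the worst case error is $e(S_n,F,H)=\sup_{\|f\|_F\le1}\|S(f)-S_n(f)\|_H$. $\mathcal{N}_n(\mathcal{B})$ is the class of all (linear or nonlinear) mappings $S_n:F\to H$ of the form $S_n(f)=\sum_{k=1}^nc_kh_{i_k}$, where the scalars $c_k$ and the indices $i_k$ may depend arbitrarily on $f$. The nonlinear widths are $$e_{n,C}^{\mathrm{non}}(S,F,H)=\inf_{\mathcal{B}\in\mathcal{B}_C}\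 \inf_{S_n\in\mathcal{N}_n(\mathcal{B})}e(S_n,F,H).$$ The $n$-th Bernstein width $b_n(S,F,H)$ is the radius of the largest $(n+1)$-dimensional ball (centered at the origin) of $H$ contained in $S(\{f\in F:\|f\|_F\le1\})$; equivalently (as $S$ is injective) $b_n(S,F,H)=\sup_X\inf_{0\ne x\in X}\|Sx\|_H/\|x\|_F$, the supremum over all $(n+1)$-dimensional subspaces $X\subset F$. *)

theory Defs
  imports "HOL-Analysis.Analysis"
begin

definition boundedly_invertible :: "('a::real_normed_vector \<Rightarrow> 'b::real_normed_vector) \<Rightarrow> bool"
  where "boundedly_invertible T \<longleftrightarrow> bounded_linear T \<and> bij T \<and> bounded_linear (inv T)"

text \<open>The values of \<open>q\<close> outside \<open>F\<close> are irrelevant.\<close>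

definition quasi_norm_on :: "'g::real_vector set \<Rightarrow> ('g \<Rightarrow> real) \<Rightarrow> bool"
  where "quasi_norm_on F q \<longleftrightarrow>
    (\<forall>x\<in>F. 0 \<le> q x) \<and>
    (\<forall>x\<in>F. q x = 0 \<longleftrightarrow> x = 0) \<and>
    (\<forall>c. \<forall>x\<in>F. q (c *\<^sub>R x) = \<bar>c\<bar> * q x) \<and>
    (\<exists>K\<ge>1. \<forall>x\<in>F. \<forall>y\<in>F. q (x + y) \<le> K * (q x + q y))"

definition riesz_lower_bound :: "(nat \<Rightarrow> 'h::real_normed_vector) \<Rightarrow> real \<Rightarrow> bool"
  where "riesz_lower_bound h A \<longleftrightarrow>
    (\<forall>\<alpha>::nat \<Rightarrow> real. finite {k. \<alpha> k \<noteq> 0} \<longrightarrow>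
      A * sqrt (\<Sum>k | \<alpha> k \<noteq> 0. (\<alpha> k)\<^sup>2) \<le> norm (\<Sum>k | \<alpha> k \<noteq> 0. \<alpha> k *\<^sub>R h k))"

definition riesz_upper_bound :: "(nat \<Rightarrow> 'h::real_normed_vector) \<Rightarrow> real \<Rightarrow> bool"
  where "riesz_upper_bound h B \<longleftrightarrow>
    (\<forall>\<alpha>::nat \<Rightarrow> real. finite {k. \<alpha> k \<noteq> 0} \<longrightarrow>
      norm (\<Sum>k | \<alpha> k \<noteq> 0. \<alpha> k *\<^sub>R h k) \<le> B * sqrt (\<Sum>k | \<alpha> k \<noteq> 0. (\<alpha> k)\<^sup>2))"

definition riesz_basis :: "(nat \<Rightarrow> 'h::real_normed_vector) \<Rightarrow> bool"
  where "riesz_basis h \<longleftrightarrow>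
    (\<exists>A>0. riesz_lower_bound h A) \<and> (\<exists>B>0. riesz_upper_bound h B) \<and>
    closure (span (range h)) = UNIV"

text \<open>The optimal constants; for a Riesz basis the supremum and infimum are of nonempty,
  bounded sets of positive reals.\<close>

definition riesz_lower_const :: "(nat \<Rightarrow> 'h::real_normed_vector) \<Rightarrow> real"
  where "riesz_lower_const h = Sup {A. 0 < A \<and> riesz_lower_bound h A}"

definition riesz_upper_const :: "(nat \<Rightarrow> 'h::real_normed_vector) \<Rightarrow> real"
  where "riesz_upper_const h = Inf {B. 0 < B \<and> riesz_upper_bound h B}"

definition riesz_bases :: "real \<Rightarrow> (nat \<Rightarrow> 'h::real_normed_vector) set"
  where "riesz_bases C = {h. riesz_basis h \<and> riesz_upper_const h / riesz_lower_const h \<le> C}"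

text \<open>A mapping from \<open>F\<close> is a total function of which only the values on \<open>F\<close> are used.
  The coefficients and indices are chosen separately for each \<open>f\<close>, with no regularity imposed.\<close>

definition nterm_maps :: "nat \<Rightarrow> 'g set \<Rightarrow> (nat \<Rightarrow> 'h::real_vector) \<Rightarrow> ('g \<Rightarrow> 'h) set"
  where "nterm_maps n F h =
    {T. \<forall>f\<in>F. \<exists>(c::nat \<Rightarrow> real) (i::nat \<Rightarrow> nat). T f = (\<Sum>k=1..n. c k *\<^sub>R h (i k))}"

text \<open>Errors and widths are extended nonnegative reals, so that infima over no bases are
  \<open>\<infinity>\<close>, suprema over no subspaces are \<open>0\<close>, and \<open>S\<close> may be unbounded with respect to \<open>q\<close>.\<close>

definition worst_case_error ::
    "('g \<Rightarrow> 'h::real_normed_vector) \<Rightarrow> 'g set \<Rightarrow> ('g \<Rightarrow> real) \<Rightarrow> ('g \<Rightarrow> 'h) \<Rightarrow> ennreal"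
  where "worst_case_error S F q T = (SUP f\<in>{f\<in>F. q f \<le> 1}. ennreal (norm (S f - T f)))"

definition nonlinear_width ::
    "nat \<Rightarrow> real \<Rightarrow> ('g \<Rightarrow> 'h::real_normed_vector) \<Rightarrow> 'g set \<Rightarrow> ('g \<Rightarrow> real) \<Rightarrow> ennreal"
  where "nonlinear_width n C S F q =
    (INF h\<in>riesz_bases C. INF T\<in>nterm_maps n F h. worst_case_error S F q T)"

text \<open>The supremum of the radii of \<open>(n+1)\<close>-dimensional balls contained in the image of the unit
  ball of \<open>F\<close>. Infinite-dimensional subspaces have \<open>dim V = 0\<close> and are thus excluded.\<close>

definition bernstein_width ::
    "nat \<Rightarrow> ('g \<Rightarrow> 'h::real_normed_vector) \<Rightarrow> 'g set \<Rightarrow> ('g \<Rightarrow> real) \<Rightarrow> ennreal"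
  where "bernstein_width n S F q =
    Sup {ennreal r | r V. 0 \<le> r \<and> subspace V \<and> dim V = n + 1 \<and>
      cball 0 r \<inter> V \<subseteq> S ` {f\<in>F. q f \<le> 1}}"

lemma bernstein_width_eq:
  fixes L :: "'g::real_normed_vector \<Rightarrow> 'h::real_normed_vector"
  assumes "linear L" "inj L" and F: "subspace F" and q: "quasi_norm_on F q"
    and S: "\<And>f. f \<in> F \<Longrightarrow> S f = L f"
  shows "bernstein_width n S F q =
    (SUP X\<in>{X. subspace X \<and> X \<subseteq> F \<and> dim X = n + 1}. INF x\<in>X - {0}. ennreal (norm (S x) / q x))"
    (is "_ = ?R")
proof (rule antisym)
  note lin = \<open>linear L\<close>
  have q0: "\<And>x. x \<in> F \<Longrightarrow> 0 \<le> q x" "\<And>x. x \<in> F \<Longrightarrow> q x = 0 \<longleftrightarrow> x = 0"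
    "\<And>c x. x \<in> F \<Longrightarrow> q (c *\<^sub>R x) = \<bar>c\<bar> * q x"
    using q unfolding quasi_norm_on_def by auto
  have qpos: "\<And>x. x \<in> F \<Longrightarrow> x \<noteq> 0 \<Longrightarrow> 0 < q x" using q0 by (metis less_le)
  have L0: "L x = 0 \<longleftrightarrow> x = 0" for x using \<open>inj L\<close> linear_0[OF lin] by (metis injD)
  have dimL: "dim (L ` X) = dim X" if "subspace X" for X
  proof -
    obtain B where B: "B \<subseteq> X" "independent B" "X \<subseteq> span B" "card B = dim X"
      by (rule basis_exists)
    have "independent (L ` B)"
      using B(2) inj_on_subset[OF \<open>inj L\<close>] by (intro linear_independent_injective_image[OF lin]) auto
    moreover have "span B = X" using B that by (simp add: span_minimal subset_antisym)
    then have "span (L ` B) = L ` X" using linear_span_image[OF lin] by metis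
    then have "span (L ` B) = span (L ` X)" by (metis span_span)
    ultimately have "dim (L ` X) = card (L ` B)" by (metis dim_eq_card)
    then show ?thesis using B(4) \<open>inj L\<close> by (metis card_image inj_on_subset subset_UNIV)
  qed
  show "bernstein_width n S F q \<le> ?R"
    unfolding bernstein_width_def
  proof (rule Sup_least, clarify)
    fix r :: real and V :: "'h set"
    assume r: "0 \<le> r" and V: "subspace V" "dim V = n + 1"
      and sub: "cball 0 r \<inter> V \<subseteq> S ` {f\<in>F. q f \<le> 1}"
    show "ennreal r \<le> ?R"
    proof (cases "r = 0")
      case False
      with r have r: "r > 0" by simp
      define X where "X = L -` V"
      have X: "subspace X" unfolding X_def using V(1) by (rule linear_subspace_vimage[OF lin])
      have key: "\<exists>x\<in>F. L x = v \<and> r * q x \<le> norm v" if v: "v \<in> V" for v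
      proof (cases "v = 0")
        case True
        moreover have "0 \<in> F" "q 0 = 0" using F q0(2)[of 0] subspace_0 by auto
        ultimately show ?thesis using L0 by (intro bexI[of _ 0]) auto
      next
        case False
        define w where "w = (r / norm v) *\<^sub>R v"
        have "w \<in> cball 0 r \<inter> V" using v V r False by (auto simp: w_def subspace_scale)
        then obtain f where f: "f \<in> F" "q f \<le> 1" "L f = w" using sub S by force
        let ?x = "(norm v / r) *\<^sub>R f"
        have "L ?x = v" using f False r by (simp add: linear_scale[OF lin] w_def)
        moreover have "?x \<in> F" using f F by (simp add: subspace_scale)
        moreover have "r * q ?x \<le> norm v"
          using f r q0(3) mult_left_le[of "q f" "norm v"] by simp
        ultimately show ?thesis by blast
      qed
      have XF: "X \<subseteq> F" unfolding X_def using key \<open>inj L\<close> by (force dest: injD)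
      have "L ` X = V" unfolding X_def using key by (auto simp: image_iff)
      then have dX: "dim X = n + 1" using dimL X V by metis
      have "ennreal r \<le> (INF x\<in>X - {0}. ennreal (norm (S x) / q x))"
      proof (rule INF_greatest)
        fix x assume x: "x \<in> X - {0}"
        then have xF: "x \<in> F" using XF by auto
        obtain y where "y \<in> F" "L y = L x" "r * q y \<le> norm (L x)"
          using key[of "L x"] x by (auto simp: X_def)
        then have "r * q x \<le> norm (S x)" using \<open>inj L\<close> S xF by (metis injD)
        then show "ennreal r \<le> ennreal (norm (S x) / q x)"
          using qpos xF x by (intro ennreal_leI) (simp add: pos_le_divide_eq)
      qed
      then show ?thesis using X XF dX by (intro SUP_upper2[of X]) auto
    qed simp
  qed
  show "?R \<le> bernstein_width n S F q"
  proof (rule SUP_least, clarify)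
    fix X :: "'g set" assume X: "subspace X" "X \<subseteq> F" "dim X = n + 1"
    let ?I = "INF x\<in>X - {0}. ennreal (norm (S x) / q x)"
    have "dim {0::'g} = 0" using dim_eq_card[of "{}" "{0::'g}"] by (simp add: real_vector.independent_empty)
    then have "X \<noteq> {0}" using X(3) by auto
    then obtain x where x: "x \<in> X" "x \<noteq> 0" using X(1) subspace_0 by fastforce
    have "?I \<le> ennreal (norm (S x) / q x)" using x by (intro INF_lower) auto
    then have "?I < top" using ennreal_less_top order_le_less_trans by blast
    then obtain r where r: "0 \<le> r" "?I = ennreal r" by (cases ?I) auto
    have le: "r * q x \<le> norm (L x)" if "x \<in> X" for x
    proof (cases "x = 0")
      case True then show ?thesis using that X q0(2)[of x] by auto
    next
      case False
      have "ennreal r \<le> ennreal (norm (S x) / q x)"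
        unfolding r(2)[symmetric] using that False by (intro INF_lower) auto
      then have "r \<le> norm (S x) / q x"
        using that X q0(1)[of x] by (subst (asm) ennreal_le_iff) auto
      then show ?thesis using qpos[of x] that False X S[of x] by (auto simp: pos_le_divide_eq)
    qed
    have "cball 0 r \<inter> L ` X \<subseteq> S ` {f\<in>F. q f \<le> 1}"
    proof clarify
      fix x assume x: "x \<in> X" "L x \<in> cball 0 r"
      show "L x \<in> S ` {f\<in>F. q f \<le> 1}"
      proof (cases "x = 0")
        case True
        then show ?thesis using x X q0(2)[of 0] S[of 0] by (intro image_eqI[of _ _ x]) auto
      next
        case False
        have "0 < norm (L x)" using False L0 by simp
        then have "r > 0" using x(2) order_less_le_trans by (auto simp del: zero_less_norm_iff)
        moreover have "r * q x \<le> r * 1" using le[of x] x by simp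
        ultimately have "q x \<le> 1" using mult_le_cancel_left_pos by blast
        then show ?thesis using x X S[of x] by (intro image_eqI[of _ _ x]) auto
      qed
    qed
    moreover have "subspace (L ` X)" using X by (simp add: linear_subspace_image[OF lin])
    moreover have "dim (L ` X) = n + 1" using dimL X by simp
    ultimately show "?I \<le> bernstein_width n S F q"
      unfolding bernstein_width_def r(2) using r(1) by (intro Sup_upper) blast
  qed
qed

end

theory Submission
  imports Defs
begin

text \<open>Every finite-dimensional space of real sequences contains a flat vector, one whose maximal
  modulus is attained in at least as many coordinates as the space has dimensions. Dropping \<open>n\<close>
  coordinates of a flat vector in dimension at least \<open>4 * n\<close> costs at most a quarter of its squared
  Euclidean norm. Hence, up to the factor \<open>C\<close> with which a Riesz basis distorts the Euclidean norm,
  such a vector is badly approximated by \<open>n\<close> terms. Coefficient sequences with respect to the basis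
  are kept finite by slightly perturbing the subspace into the algebraic span of the basis; the gap
  between \<open>sqrt (3/4)\<close> and \<open>1/2\<close> absorbs the perturbation.\<close>

section \<open>Linear algebra: flat vectors in finite-dimensional spaces\<close>

text \<open>Gaussian elimination, by induction on the equations: a nonzero pivot in equation
  \<open>k\<close> eliminates one unknown from all the others. Elimination changes the coefficients,
  so \<open>a\<close> is generalized along with \<open>J\<close>.\<close>

lemma homogeneous_system_nontrivial_solution:
  fixes a :: "'k \<Rightarrow> 'j \<Rightarrow> 'f::field"
  assumes "finite M" "finite J" "card M < card J"
  shows "\<exists>c. (\<exists>j\<in>J. c j \<noteq> 0) \<and> (\<forall>k\<in>M. (\<Sum>j\<in>J. a k j * c j) = 0)"
  using assms
proof (induction M arbitrary: J a rule: finite_induct)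
  case empty
  then have "J \<noteq> {}" by auto
  then show ?case by (intro exI[of _ "\<lambda>_. 1"]) auto
next
  case (insert k M)
  show ?case
  proof (cases "\<forall>j\<in>J. a k j = 0")
    case True
    obtain c where "\<exists>j\<in>J. c j \<noteq> 0" "\<forall>i\<in>M. (\<Sum>j\<in>J. a i j * c j) = 0"
      using insert.IH[of J a] insert.prems insert.hyps by auto
    then show ?thesis using True by (intro exI[of _ c]) auto
  next
    case False
    then obtain p where p: "p \<in> J" "a k p \<noteq> 0" by auto
    define J' where "J' = J - {p}"
    have J: "J = insert p J'" "p \<notin> J'" "finite J'"
      using p insert.prems by (auto simp: J'_def)
    have "card M < card J'" using insert.prems insert.hyps J by simp
    then obtain c where c: "\<exists>j\<in>J'. c j \<noteq> 0"
      "\<forall>i\<in>M. (\<Sum>j\<in>J'. (a i j - a k j / a k p * a i p) * c j) = 0"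
      using insert.IH[of J' "\<lambda>i j. a i j - a k j / a k p * a i p"] J by auto
    \<comment> \<open>Back substitution: equation \<open>k\<close> forces the eliminated unknown to
      be \<open>- s\<close>.\<close>
    define s where "s = (\<Sum>j\<in>J'. a k j * c j) / a k p"
    define c' where "c' = c(p := - s)"
    have c': "(\<Sum>j\<in>J. a i j * c' j) = (\<Sum>j\<in>J'. a i j * c j) - a i p * s" for i
    proof -
      have "(\<Sum>j\<in>J'. a i j * c' j) = (\<Sum>j\<in>J'. a i j * c j)"
        using J by (intro sum.cong) (auto simp: c'_def)
      then show ?thesis using J by (simp add: c'_def)
    qed
    have "(\<Sum>j\<in>J. a i j * c' j) = 0" if "i \<in> M" for i
    proof -
      have "0 = (\<Sum>j\<in>J'. a i j * c j - a i p / a k p * (a k j * c j))"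
        using c(2) that by (simp add: algebra_simps)
      also have "\<dots> = (\<Sum>j\<in>J'. a i j * c j) - a i p * s"
        by (simp add: s_def sum_subtractf sum_distrib_left sum_divide_distrib)
      finally show ?thesis using c' by simp
    qed
    moreover have "(\<Sum>j\<in>J. a k j * c' j) = 0"
      using p unfolding c' by (simp add: s_def)
    moreover have "\<exists>j\<in>J. c' j \<noteq> 0"
      using c(1) J by (auto simp: c'_def)
    ultimately show ?thesis by (intro exI[of _ c']) auto
  qed
qed

text \<open>If fewer coordinates than the dimension are extremal, move in a direction that
  vanishes on them until a further coordinate becomes extremal.\<close>

lemma exists_flat_combination:
  fixes a :: "'k \<Rightarrow> 'j \<Rightarrow> real"
  assumes fin: "finite J" "finite K"
    and inj: "\<And>c. \<exists>j\<in>J. c j \<noteq> 0 \<Longrightarrow> \<exists>k\<in>K. (\<Sum>j\<in>J. a k j * c j) \<noteq> 0"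
  obtains c \<mu> where "\<mu> > 0" "\<And>k. k \<in> K \<Longrightarrow> \<bar>\<Sum>j\<in>J. a k j * c j\<bar> \<le> \<mu>"
    "card J \<le> card {k\<in>K. \<bar>\<Sum>j\<in>J. a k j * c j\<bar> = \<mu>}"
proof -
  define \<phi> where "\<phi> c k = (\<Sum>j\<in>J. a k j * c j)" for c k
  have "\<exists>c \<mu>. \<mu> > 0 \<and> (\<forall>k\<in>K. \<bar>\<phi> c k\<bar> \<le> \<mu>) \<and> p \<le> card {k\<in>K. \<bar>\<phi> c k\<bar> = \<mu>}"
    if "p \<le> card J" for p
    using that
  proof (induction p)
    case 0
    \<comment> \<open>With no extremal coordinate required, \<open>\<mu>\<close> need only be a
      positive bound, so the zero combination serves as the start.\<close>
    show ?case by (intro exI[of _ "\<lambda>_. 0"] exI[of _ 1]) (simp add: \<phi>_def)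
  next
    case (Suc p)
    then obtain c \<mu> where c: "\<mu> > 0" "\<And>k. k \<in> K \<Longrightarrow> \<bar>\<phi> c k\<bar> \<le> \<mu>"
      "p \<le> card {k\<in>K. \<bar>\<phi> c k\<bar> = \<mu>}" by auto
    define M where "M = {k\<in>K. \<bar>\<phi> c k\<bar> = \<mu>}"
    show ?case
    proof (cases "Suc p \<le> card M")
      case True
      then show ?thesis using c unfolding M_def by blast
    next
      case False
      then have M: "card M = p" using c(3) by (simp add: M_def)
      have finM: "finite M" using fin by (simp add: M_def)
      obtain w where w: "\<exists>j\<in>J. w j \<noteq> 0" "\<And>k. k \<in> M \<Longrightarrow> \<phi> w k = 0"
        using homogeneous_system_nontrivial_solution[OF finM fin(1), of a] Suc.prems M
        unfolding \<phi>_def by auto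
      define N where "N = {k\<in>K. \<phi> w k \<noteq> 0}"
      have N: "finite N" "N \<noteq> {}" using fin inj[OF w(1)] by (auto simp: N_def \<phi>_def)
      \<comment> \<open>Along the ray \<open>c + t * w\<close>, coordinate \<open>k\<close> moves in
        the direction of the sign of \<open>\<phi> w k\<close>; \<open>\<tau> k\<close> is the time
        at which it reaches modulus \<open>\<mu>\<close> with that sign. The minimum
        \<open>t\<close> is the first such time, so no coordinate has passed \<open>\<mu>\<close> by
        then.\<close>
      define \<tau> where "\<tau> k = (\<mu> - sgn (\<phi> w k) * \<phi> c k) / \<bar>\<phi> w k\<bar>" for k
      define t where "t = Min (\<tau> ` N)"
      have le: "t \<le> \<tau> k" if "k \<in> N" for k
        using that N by (simp add: t_def)
      obtain l where l: "l \<in> N" "t = \<tau> l"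
        using Min_in[of "\<tau> ` N"] N unfolding t_def by blast
      have "sgn (\<phi> w l) * \<phi> c l \<le> \<mu>"
        using c(2)[of l] l by (auto simp: N_def sgn_if)
      then have t0: "t \<ge> 0" unfolding l \<tau>_def by simp
      have split: "\<phi> (\<lambda>j. c j + t * w j) k = \<phi> c k + t * \<phi> w k" for k
        by (simp add: \<phi>_def sum.distrib sum_distrib_left algebra_simps)
      have bound: "\<bar>\<phi> c k + t * \<phi> w k\<bar> \<le> \<mu>" if "k \<in> K" for k
      proof (cases "k \<in> N")
        case True
        then have "t * \<bar>\<phi> w k\<bar> \<le> \<mu> - sgn (\<phi> w k) * \<phi> c k" "\<phi> w k \<noteq> 0"
          using le[OF True] by (auto simp: \<tau>_def N_def pos_le_divide_eq)
        moreover have "0 \<le> t * \<bar>\<phi> w k\<bar>" using t0 by simp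
        ultimately show ?thesis using c(2)[OF that]
          by (auto simp: sgn_if abs_if split: if_splits)
      next
        case False
        then show ?thesis using c(2)[OF that] that by (simp add: N_def)
      qed
      have "t * \<bar>\<phi> w l\<bar> = \<mu> - sgn (\<phi> w l) * \<phi> c l" "\<phi> w l \<noteq> 0"
        using l by (auto simp: \<tau>_def N_def)
      then have eq: "\<bar>\<phi> c l + t * \<phi> w l\<bar> = \<mu>"
        using c(1) by (auto simp: sgn_if abs_if split: if_splits)
      \<comment> \<open>The old extremal coordinates stay put because \<open>w\<close> vanishes on
        \<open>M\<close>; \<open>l\<close> is new because \<open>w\<close> does not vanish
        there.\<close>
      have sub: "insert l M \<subseteq> {k\<in>K. \<bar>\<phi> c k + t * \<phi> w k\<bar> = \<mu>}"
      proof
        fix k assume "k \<in> insert l M"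
        moreover have "l \<in> K" using l by (simp add: N_def)
        moreover have "\<bar>\<phi> c k + t * \<phi> w k\<bar> = \<mu>" "k \<in> K" if "k \<in> M"
          using that w(2)[OF that] by (simp_all add: M_def)
        ultimately show "k \<in> {k\<in>K. \<bar>\<phi> c k + t * \<phi> w k\<bar> = \<mu>}" using eq by blast
      qed
      have "l \<notin> M" using l w(2) by (auto simp: N_def)
      then have "Suc p = card (insert l M)" using M finM by simp
      also have "\<dots> \<le> card {k\<in>K. \<bar>\<phi> c k + t * \<phi> w k\<bar> = \<mu>}"
        using fin sub by (intro card_mono) simp_all
      finally show ?thesis
        using bound c(1) by (intro exI[of _ "\<lambda>j. c j + t * w j"] exI[of _ \<mu>]) (simp add: split)
    qed
  qed
  from this[OF order_refl] show thesis
    using that unfolding \<phi>_def by blast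
qed

text \<open>Each removed coordinate carries at most \<open>\<mu>\<^sup>2\<close>, while the extremal
  ones, at least four times as many, carry exactly \<open>\<mu>\<^sup>2\<close> each.\<close>

lemma flat_remainder:
  fixes \<alpha> :: "'k \<Rightarrow> real"
  assumes fin: "finite K" "finite I" and flat: "\<And>k. k \<in> K \<Longrightarrow> \<bar>\<alpha> k\<bar> \<le> \<mu>"
    and card: "4 * card I \<le> card {k\<in>K. \<bar>\<alpha> k\<bar> = \<mu>}"
  shows "3 / 4 * (\<Sum>k\<in>K. (\<alpha> k)\<^sup>2) \<le> (\<Sum>k\<in>K - I. (\<alpha> k)\<^sup>2)"
proof -
  have "(\<alpha> k)\<^sup>2 \<le> \<mu>\<^sup>2" if "k \<in> K" for k
    using power_mono[OF flat[OF that], of 2] by simp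
  then have "(\<Sum>k\<in>K \<inter> I. (\<alpha> k)\<^sup>2) \<le> real (card (K \<inter> I)) * \<mu>\<^sup>2"
    by (intro sum_bounded_above) auto
  also have "\<dots> \<le> real (card I) * \<mu>\<^sup>2"
    using fin by (intro mult_right_mono) (auto intro: card_mono)
  finally have "4 * (\<Sum>k\<in>K \<inter> I. (\<alpha> k)\<^sup>2) \<le> real (4 * card I) * \<mu>\<^sup>2" by simp
  also have "\<dots> \<le> real (card {k\<in>K. \<bar>\<alpha> k\<bar> = \<mu>}) * \<mu>\<^sup>2"
    using card by (intro mult_right_mono) auto
  also have "\<dots> = (\<Sum>k | k \<in> K \<and> \<bar>\<alpha> k\<bar> = \<mu>. (\<alpha> k)\<^sup>2)"
  proof -
    have "(\<alpha> k)\<^sup>2 = \<mu>\<^sup>2" if "\<bar>\<alpha> k\<bar> = \<mu>" for k using that by auto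
    then show ?thesis by simp
  qed
  also have "\<dots> \<le> (\<Sum>k\<in>K. (\<alpha> k)\<^sup>2)"
    using fin by (intro sum_mono2) auto
  finally have "4 * (\<Sum>k\<in>K \<inter> I. (\<alpha> k)\<^sup>2) \<le> (\<Sum>k\<in>K. (\<alpha> k)\<^sup>2)" .
  moreover have "(\<Sum>k\<in>K. (\<alpha> k)\<^sup>2) = (\<Sum>k\<in>K \<inter> I. (\<alpha> k)\<^sup>2) + (\<Sum>k\<in>K - I. (\<alpha> k)\<^sup>2)"
    using fin(1) by (rule sum.Int_Diff)
  ultimately show ?thesis by simp
qed

section \<open>Riesz bounds and the optimal constants\<close>

text \<open>The definition sums over the exact support. Extending by zero from \<open>K\<close>
  frees the index set: coefficients may vanish on \<open>K\<close> and are arbitrary off it.\<close>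

lemma riesz_lower_boundD:
  assumes "riesz_lower_bound h A" "finite K"
  shows "A * sqrt (\<Sum>k\<in>K. (\<alpha> k)\<^sup>2) \<le> norm (\<Sum>k\<in>K. \<alpha> k *\<^sub>R h k)"
proof -
  define \<beta> where "\<beta> k = (if k \<in> K then \<alpha> k else 0)" for k
  have sub: "{k. \<beta> k \<noteq> 0} \<subseteq> K" by (auto simp: \<beta>_def)
  have "(\<Sum>k | \<beta> k \<noteq> 0. (\<beta> k)\<^sup>2) = (\<Sum>k\<in>K. (\<alpha> k)\<^sup>2)"
    "(\<Sum>k | \<beta> k \<noteq> 0. \<beta> k *\<^sub>R h k) = (\<Sum>k\<in>K. \<alpha> k *\<^sub>R h k)"
    using assms(2) sub by (auto intro!: sum.mono_neutral_cong_left simp: \<beta>_def)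
  then show ?thesis
    using assms(1)[unfolded riesz_lower_bound_def, rule_format, OF finite_subset[OF sub assms(2)]]
    by (simp only:)
qed

lemma riesz_upper_boundD:
  assumes "riesz_upper_bound h B" "finite K"
  shows "norm (\<Sum>k\<in>K. \<alpha> k *\<^sub>R h k) \<le> B * sqrt (\<Sum>k\<in>K. (\<alpha> k)\<^sup>2)"
proof -
  define \<beta> where "\<beta> k = (if k \<in> K then \<alpha> k else 0)" for k
  have sub: "{k. \<beta> k \<noteq> 0} \<subseteq> K" by (auto simp: \<beta>_def)
  have "(\<Sum>k | \<beta> k \<noteq> 0. (\<beta> k)\<^sup>2) = (\<Sum>k\<in>K. (\<alpha> k)\<^sup>2)"
    "(\<Sum>k | \<beta> k \<noteq> 0. \<beta> k *\<^sub>R h k) = (\<Sum>k\<in>K. \<alpha> k *\<^sub>R h k)"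
    using assms(2) sub by (auto intro!: sum.mono_neutral_cong_left simp: \<beta>_def)
  then show ?thesis
    using assms(1)[unfolded riesz_upper_bound_def, rule_format, OF finite_subset[OF sub assms(2)]]
    by (simp only:)
qed

text \<open>The optimal constant is itself admissible: for a fixed nonzero \<open>\<alpha>\<close>
  every admissible \<open>A\<close> lies below one quotient, and so does their supremum.\<close>

lemma riesz_lower_const_bound:
  assumes "riesz_basis h"
  shows "riesz_lower_bound h (riesz_lower_const h)"
  unfolding riesz_lower_bound_def
proof (intro allI impI)
  fix \<alpha> :: "nat \<Rightarrow> real"
  assume fin: "finite {k. \<alpha> k \<noteq> 0}"
  let ?s = "sqrt (\<Sum>k | \<alpha> k \<noteq> 0. (\<alpha> k)\<^sup>2)"
  let ?v = "norm (\<Sum>k | \<alpha> k \<noteq> 0. \<alpha> k *\<^sub>R h k)"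
  show "riesz_lower_const h * ?s \<le> ?v"
  proof (cases "?s = 0")
    case False
    then have s: "?s > 0" by (metis less_le real_sqrt_ge_zero sum_nonneg zero_le_power2)
    have "riesz_lower_const h \<le> ?v / ?s"
      unfolding riesz_lower_const_def
    proof (rule cSup_least)
      show "{A. 0 < A \<and> riesz_lower_bound h A} \<noteq> {}"
        using assms by (auto simp: riesz_basis_def)
    next
      fix A assume "A \<in> {A. 0 < A \<and> riesz_lower_bound h A}"
      then have "A * ?s \<le> ?v" using fin by (auto simp: riesz_lower_bound_def)
      then show "A \<le> ?v / ?s" using s by (subst pos_le_divide_eq)
    qed
    then show ?thesis using s by (subst (asm) pos_le_divide_eq)
  qed auto
qed

lemma riesz_upper_const_bound:
  assumes "riesz_basis h"
  shows "riesz_upper_bound h (riesz_upper_const h)"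
  unfolding riesz_upper_bound_def
proof (intro allI impI)
  fix \<alpha> :: "nat \<Rightarrow> real"
  assume fin: "finite {k. \<alpha> k \<noteq> 0}"
  let ?s = "sqrt (\<Sum>k | \<alpha> k \<noteq> 0. (\<alpha> k)\<^sup>2)"
  let ?v = "norm (\<Sum>k | \<alpha> k \<noteq> 0. \<alpha> k *\<^sub>R h k)"
  have B: "?v \<le> B * ?s" if "riesz_upper_bound h B" for B
    using that fin by (auto simp: riesz_upper_bound_def)
  have ne: "{B. 0 < B \<and> riesz_upper_bound h B} \<noteq> {}"
    using assms by (auto simp: riesz_basis_def)
  show "?v \<le> riesz_upper_const h * ?s"
  proof (cases "?s = 0")
    case False
    then have s: "?s > 0" by (metis less_le real_sqrt_ge_zero sum_nonneg zero_le_power2)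
    have "?v / ?s \<le> riesz_upper_const h"
      unfolding riesz_upper_const_def
    proof (rule cInf_greatest[OF ne])
      fix B assume "B \<in> {B. 0 < B \<and> riesz_upper_bound h B}"
      then show "?v / ?s \<le> B" using s B by (subst pos_divide_le_eq) auto
    qed
    then show ?thesis using s by (subst (asm) pos_divide_le_eq)
  next
    case True
    \<comment> \<open>No division is possible here; any admissible bound already shows that the
      combination is zero.\<close>
    obtain B where "riesz_upper_bound h B" using ne by auto
    from B[OF this] show ?thesis unfolding True by simp
  qed
qed

text \<open>The supremum says something only for a set bounded above; testing with the single vector
  \<open>h 0\<close> bounds every admissible \<open>A\<close> by its norm.\<close>

lemma riesz_lower_const_pos:
  assumes "riesz_basis h"
  shows "riesz_lower_const h > 0"
proof -
  obtain A where A: "A > 0" "riesz_lower_bound h A"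
    using assms by (auto simp: riesz_basis_def)
  have "bdd_above {A. 0 < A \<and> riesz_lower_bound h A}"
  proof (rule bdd_aboveI)
    fix A assume "A \<in> {A. 0 < A \<and> riesz_lower_bound h A}"
    then show "A \<le> norm (h 0)"
      using riesz_lower_boundD[of h A "{0}" "\<lambda>_. 1"] by simp
  qed
  then have "A \<le> riesz_lower_const h"
    unfolding riesz_lower_const_def using A by (intro cSup_upper) auto
  then show ?thesis using A by simp
qed

text \<open>Clears the quotient of optimal constants, leaving one scale \<open>A\<close> and the
  distortion \<open>C\<close>.\<close>

lemma riesz_bases_bounds:
  assumes "h \<in> riesz_bases C"
  obtains A where "A > 0" "riesz_lower_bound h A" "riesz_upper_bound h (C * A)"
proof
  let ?A = "riesz_lower_const h"
  have h: "riesz_basis h" "riesz_upper_const h / ?A \<le> C"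
    using assms by (auto simp: riesz_bases_def)
  show A: "?A > 0" "riesz_lower_bound h ?A"
    using riesz_lower_const_pos riesz_lower_const_bound h by auto
  have le: "riesz_upper_const h \<le> C * ?A" using h A by (simp add: pos_divide_le_eq)
  show "riesz_upper_bound h (C * ?A)"
    unfolding riesz_upper_bound_def
  proof (intro allI impI)
    fix \<alpha> :: "nat \<Rightarrow> real" assume fin: "finite {k. \<alpha> k \<noteq> 0}"
    have "norm (\<Sum>k | \<alpha> k \<noteq> 0. \<alpha> k *\<^sub>R h k)
        \<le> riesz_upper_const h * sqrt (\<Sum>k | \<alpha> k \<noteq> 0. (\<alpha> k)\<^sup>2)"
      using riesz_upper_boundD[OF riesz_upper_const_bound[OF h(1)] fin] .
    also have "\<dots> \<le> C * ?A * sqrt (\<Sum>k | \<alpha> k \<noteq> 0. (\<alpha> k)\<^sup>2)"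
      using le by (intro mult_right_mono) (auto intro: sum_nonneg)
    finally show "norm (\<Sum>k | \<alpha> k \<noteq> 0. \<alpha> k *\<^sub>R h k)
        \<le> C * ?A * sqrt (\<Sum>k | \<alpha> k \<noteq> 0. (\<alpha> k)\<^sup>2)" .
  qed
qed

section \<open>Finite expansions and orthogonal bases\<close>

text \<open>Turns membership in the span into coefficients indexed by naturals, the form in which
  the Riesz bounds are stated.\<close>

lemma span_range_finite_combination:
  assumes "x \<in> span (range h)"
  shows "\<exists>\<alpha>. finite {k. \<alpha> k \<noteq> 0} \<and> x = (\<Sum>k | \<alpha> k \<noteq> 0. \<alpha> k *\<^sub>R h k)"
  using assms
proof (induction rule: span_induct_alt)
  case base
  show ?case by (intro exI[of _ "\<lambda>_. 0"]) simp
next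
  case (step c x y)
  then obtain \<alpha> k where \<alpha>: "finite {k. \<alpha> k \<noteq> 0}" "y = (\<Sum>k | \<alpha> k \<noteq> 0. \<alpha> k *\<^sub>R h k)"
    and x: "x = h k" by auto
  \<comment> \<open>Adding \<open>c\<close> at \<open>k\<close> may enlarge or shrink the support,
    so both sums are compared over this common superset.\<close>
  define K where "K = insert k {k. \<alpha> k \<noteq> 0}"
  define \<beta> where "\<beta> = \<alpha>(k := \<alpha> k + c)"
  have K: "finite K" "k \<in> K" using \<alpha> by (auto simp: K_def)
  have "y = (\<Sum>k\<in>K. \<alpha> k *\<^sub>R h k)"
    unfolding \<alpha>(2) using K by (intro sum.mono_neutral_left) (auto simp: K_def)
  moreover have "c *\<^sub>R x = (\<Sum>i\<in>K. if i = k then c *\<^sub>R h i else 0)"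
    using K x by simp
  ultimately have "c *\<^sub>R x + y = (\<Sum>i\<in>K. (if i = k then c *\<^sub>R h i else 0) + \<alpha> i *\<^sub>R h i)"
    by (simp only: sum.distrib)
  also have "\<dots> = (\<Sum>i\<in>K. \<beta> i *\<^sub>R h i)"
    by (intro sum.cong) (auto simp: \<beta>_def algebra_simps)
  also have "\<dots> = (\<Sum>i | \<beta> i \<noteq> 0. \<beta> i *\<^sub>R h i)"
    using K by (intro sum.mono_neutral_right) (auto simp: K_def \<beta>_def split: if_splits)
  finally have "c *\<^sub>R x + y = (\<Sum>i | \<beta> i \<noteq> 0. \<beta> i *\<^sub>R h i)" .
  moreover have "finite {i. \<beta> i \<noteq> 0}"
    using K(1) by (rule rev_finite_subset) (auto simp: K_def \<beta>_def split: if_splits)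
  ultimately show ?case by blast
qed

text \<open>Gram-Schmidt. Positive \<open>dim\<close> guarantees a finite basis, since
  infinite-dimensional spaces have \<open>dim\<close> 0.\<close>

lemma orthogonal_basis_exists:
  fixes V :: "'a::real_inner set"
  assumes "subspace V" "dim V > 0"
  obtains E where "finite E" "card E = dim V" "span E = V" "pairwise orthogonal E" "0 \<notin> E"
proof -
  obtain B where B: "B \<subseteq> V" "independent B" "V \<subseteq> span B" "card B = dim V"
    by (rule basis_exists)
  have "finite B" using B(4) assms(2) by (metis card.infinite less_nat_zero_code)
  have span: "span B = V" using B assms(1) by (simp add: span_minimal subset_antisym)
  obtain E where E: "finite E" "card E \<le> card B" "span E = span B" "pairwise orthogonal E"
    using basis_orthogonal[OF \<open>finite B\<close>] by auto
  \<comment> \<open>Orthogonal sets may contain 0; without it they are independent, which fixes the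
    cardinality.\<close>
  define D where "D = E - {0}"
  have D: "finite D" "span D = V" "pairwise orthogonal D" "0 \<notin> D"
    using E span by (auto simp: D_def span_delete_0 intro: pairwise_mono)
  then have "independent D" by (intro pairwise_orthogonal_independent)
  then have "card D = dim V" using D dim_span_eq_card_independent by metis
  with D that show thesis by blast
qed

text \<open>By Pythagoras, a combination dominates each of its terms. This turns errors in single
  basis vectors into an error relative to the whole combination.\<close>

lemma norm_orthogonal_combination_ge:
  fixes E :: "'a::real_inner set"
  assumes "finite E" "pairwise orthogonal E" "b \<in> E"
  shows "\<bar>c b\<bar> * norm b \<le> norm (\<Sum>b\<in>E. c b *\<^sub>R b)"
proof -
  have "(norm (\<Sum>b\<in>E. c b *\<^sub>R b))\<^sup>2 = (\<Sum>b\<in>E. (norm (c b *\<^sub>R b))\<^sup>2)"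
    using assms by (intro norm_sum_Pythagorean)
      (auto simp: pairwise_def orthogonal_def inner_commute)
  also have "\<dots> \<ge> (norm (c b *\<^sub>R b))\<^sup>2"
    using assms by (intro member_le_sum) auto
  finally have "norm (c b *\<^sub>R b) \<le> norm (\<Sum>b\<in>E. c b *\<^sub>R b)"
    by (rule power2_le_imp_le) simp
  then show ?thesis by simp
qed

section \<open>A vector far from all n-term combinations\<close>

text \<open>A single \<open>v\<close> is bad for all index sets and coefficients at once, so it
  defeats any nonlinear choice of them. The estimate is relative to \<open>norm v\<close> and thus
  survives rescaling.\<close>

lemma exists_badly_approximable:
  fixes h :: "nat \<Rightarrow> 'h::real_inner"
  assumes h: "h \<in> riesz_bases C" and C: "1 \<le> C"
    and V: "subspace V" "dim V > 0" "4 * n \<le> dim V"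
  obtains v where "v \<in> V" "v \<noteq> 0"
    "\<And>I t. finite I \<Longrightarrow> card I \<le> n \<Longrightarrow> norm v \<le> 2 * C * norm (v - (\<Sum>k\<in>I. t k *\<^sub>R h k))"
proof -
  obtain A where A: "A > 0" "riesz_lower_bound h A" "riesz_upper_bound h (C * A)"
    using riesz_bases_bounds[OF h] .
  obtain E where E: "finite E" "card E = dim V" "span E = V" "pairwise orthogonal E" "0 \<notin> E"
    using orthogonal_basis_exists V by metis
  \<comment> \<open>The relative perturbation must stay small after multiplication by
    \<open>C\<close>; \<open>\<delta>\<close> divides it evenly among the basis vectors.\<close>
  define \<epsilon> where "\<epsilon> = 1 / (10 * C)"
  have \<epsilon>: "\<epsilon> > 0" "C * \<epsilon> = 1 / 10" "\<epsilon> \<le> 1 / 10" using C by (auto simp: \<epsilon>_def field_simps)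
  define \<delta> where "\<delta> = \<epsilon> / real (card E)"
  have \<delta>: "\<delta> > 0" "real (card E) * \<delta> = \<epsilon>" using \<epsilon>(1) E(2) V(2) by (simp_all add: \<delta>_def)
  have "\<exists>\<alpha>. finite {k. \<alpha> k \<noteq> 0} \<and> norm (b - (\<Sum>k | \<alpha> k \<noteq> 0. \<alpha> k *\<^sub>R h k)) \<le> \<delta> * norm b"
    if "b \<in> E" for b
  proof -
    have "\<delta> * norm b > 0" using \<delta>(1) E(5) that by (intro mult_pos_pos) auto
    moreover have "b \<in> closure (span (range h))"
      using h by (simp add: riesz_bases_def riesz_basis_def)
    ultimately obtain y where "y \<in> span (range h)" "dist y b < \<delta> * norm b"
      unfolding closure_approachable by blast
    then show ?thesis using span_range_finite_combination[of y h]
      by (auto simp: dist_norm norm_minus_commute intro: less_imp_le)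
  qed
  then obtain \<alpha> where \<alpha>: "\<And>b. b \<in> E \<Longrightarrow> finite {k. \<alpha> b k \<noteq> 0}"
    "\<And>b. b \<in> E \<Longrightarrow> norm (b - (\<Sum>k | \<alpha> b k \<noteq> 0. \<alpha> b k *\<^sub>R h k)) \<le> \<delta> * norm b"
    by metis
  define K where "K = (\<Union>b\<in>E. {k. \<alpha> b k \<noteq> 0})"
  have K: "finite K" using E \<alpha> by (auto simp: K_def)
  define w where "w b = (\<Sum>k\<in>K. \<alpha> b k *\<^sub>R h k)" for b
  have w: "norm (b - w b) \<le> \<delta> * norm b" if "b \<in> E" for b
  proof -
    have "w b = (\<Sum>k | \<alpha> b k \<noteq> 0. \<alpha> b k *\<^sub>R h k)"
      unfolding w_def using K that by (intro sum.mono_neutral_right) (auto simp: K_def)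
    then show ?thesis using \<alpha> that by simp
  qed
  \<comment> \<open>Coefficient of \<open>h k\<close> when the perturbed vectors \<open>w b\<close>
    are combined with weights \<open>c b\<close>.\<close>
  define \<phi> where "\<phi> c k = (\<Sum>b\<in>E. \<alpha> b k * c b)" for c k
  have sum_w: "(\<Sum>b\<in>E. c b *\<^sub>R w b) = (\<Sum>k\<in>K. \<phi> c k *\<^sub>R h k)" for c
  proof -
    have "(\<Sum>b\<in>E. c b *\<^sub>R w b) = (\<Sum>b\<in>E. \<Sum>k\<in>K. (\<alpha> b k * c b) *\<^sub>R h k)"
      by (simp add: w_def scaleR_sum_right mult.commute)
    also have "\<dots> = (\<Sum>k\<in>K. \<phi> c k *\<^sub>R h k)"
      unfolding \<phi>_def scaleR_sum_left by (rule sum.swap)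
    finally show ?thesis .
  qed
  have pert: "norm ((\<Sum>b\<in>E. c b *\<^sub>R b) - (\<Sum>k\<in>K. \<phi> c k *\<^sub>R h k)) \<le> \<epsilon> * norm (\<Sum>b\<in>E. c b *\<^sub>R b)" for c
  proof -
    have "norm ((\<Sum>b\<in>E. c b *\<^sub>R b) - (\<Sum>k\<in>K. \<phi> c k *\<^sub>R h k)) = norm (\<Sum>b\<in>E. c b *\<^sub>R (b - w b))"
      by (simp add: sum_w[symmetric] sum_subtractf scaleR_diff_right)
    also have "\<dots> \<le> (\<Sum>b\<in>E. \<delta> * norm (\<Sum>b\<in>E. c b *\<^sub>R b))"
    proof (rule sum_norm_le)
      fix b assume b: "b \<in> E"
      have "norm (c b *\<^sub>R (b - w b)) \<le> \<bar>c b\<bar> * (\<delta> * norm b)"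
        using w[OF b] by (simp add: mult_left_mono)
      also have "\<dots> = \<delta> * (\<bar>c b\<bar> * norm b)" by simp
      also have "\<dots> \<le> \<delta> * norm (\<Sum>b\<in>E. c b *\<^sub>R b)"
        using norm_orthogonal_combination_ge[OF E(1,4) b, of c] \<delta> by (intro mult_left_mono) auto
      finally show "norm (c b *\<^sub>R (b - w b)) \<le> \<delta> * norm (\<Sum>b\<in>E. c b *\<^sub>R b)" .
    qed
    also have "\<dots> = \<epsilon> * norm (\<Sum>b\<in>E. c b *\<^sub>R b)" using \<delta>(2) by simp
    finally show ?thesis .
  qed
  \<comment> \<open>The perturbation keeps the dimension: a nonzero vector cannot be within a tenth
    of its norm of 0.\<close>
  have inj: "\<exists>k\<in>K. \<phi> c k \<noteq> 0" if c: "\<exists>b\<in>E. c b \<noteq> 0" for c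
  proof (rule ccontr)
    assume "\<not> ?thesis"
    then have "norm (\<Sum>b\<in>E. c b *\<^sub>R b) \<le> \<epsilon> * norm (\<Sum>b\<in>E. c b *\<^sub>R b)"
      using pert[of c] by simp
    also have "\<dots> \<le> 1 / 10 * norm (\<Sum>b\<in>E. c b *\<^sub>R b)"
      using \<epsilon> by (intro mult_right_mono) auto
    finally have "norm (\<Sum>b\<in>E. c b *\<^sub>R b) \<le> 0" by simp
    moreover obtain b where "b \<in> E" "c b \<noteq> 0" using c by auto
    moreover from this have "0 < \<bar>c b\<bar> * norm b"
      using E(5) by (intro mult_pos_pos) auto
    ultimately show False
      using norm_orthogonal_combination_ge[OF E(1,4), of b c] by linarith
  qed
  obtain c \<mu> where c: "\<mu> > 0" "\<And>k. k \<in> K \<Longrightarrow> \<bar>\<phi> c k\<bar> \<le> \<mu>" "card E \<le> card {k\<in>K. \<bar>\<phi> c k\<bar> = \<mu>}"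
    by (rule exists_flat_combination[OF E(1) K, of "\<lambda>k b. \<alpha> b k", folded \<phi>_def, OF inj])
      (assumption | rule that)+
  define v where "v = (\<Sum>b\<in>E. c b *\<^sub>R b)"
  define u where "u = (\<Sum>k\<in>K. \<phi> c k *\<^sub>R h k)"
  have vu: "norm (v - u) \<le> \<epsilon> * norm v" using pert[of c] by (simp add: u_def v_def)
  have "v \<in> V" unfolding v_def E(3)[symmetric] by (intro span_sum span_scale span_base)
  moreover have "v \<noteq> 0"
  proof
    assume v0: "v = 0"
    have "c b = 0" if "b \<in> E" for b
      using norm_orthogonal_combination_ge[OF E(1,4) that, of c] v0 E(5) that
      by (auto simp: v_def mult_le_0_iff)
    then have "\<phi> c k = 0" for k by (simp add: \<phi>_def)
    then show False using c(1,3) E(2) V(2) by auto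
  qed
  moreover have "norm v \<le> 2 * C * norm (v - (\<Sum>k\<in>I. t k *\<^sub>R h k))"
    if I: "finite I" "card I \<le> n" for I t
  proof -
    define z where "z = (\<Sum>k\<in>I. t k *\<^sub>R h k)"
    \<comment> \<open>Coefficients of \<open>u - z\<close>; they agree with those of
      \<open>u\<close> on \<open>K - I\<close>, where flatness leaves most of the mass.\<close>
    define \<beta> where "\<beta> k = (if k \<in> K then \<phi> c k else 0) - (if k \<in> I then t k else 0)" for k
    have "u = (\<Sum>k\<in>K \<union> I. (if k \<in> K then \<phi> c k else 0) *\<^sub>R h k)"
      "z = (\<Sum>k\<in>K \<union> I. (if k \<in> I then t k else 0) *\<^sub>R h k)"
      unfolding u_def z_def using K I by (auto intro!: sum.mono_neutral_cong_left)
    then have uz: "u - z = (\<Sum>k\<in>K \<union> I. \<beta> k *\<^sub>R h k)"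
      by (simp add: \<beta>_def scaleR_diff_left sum_subtractf)
    let ?s = "\<Sum>k\<in>K. (\<phi> c k)\<^sup>2"
    have "3 / 4 * ?s \<le> (\<Sum>k\<in>K - I. (\<phi> c k)\<^sup>2)"
      using c(3) I E(2) V(3) by (intro flat_remainder[OF K I(1) c(2)]) auto
    also have "\<dots> = (\<Sum>k\<in>K - I. (\<beta> k)\<^sup>2)" by (intro sum.cong) (auto simp: \<beta>_def)
    also have "\<dots> \<le> (\<Sum>k\<in>K \<union> I. (\<beta> k)\<^sup>2)" using K I by (intro sum_mono2) auto
    finally have le: "3 / 4 * ?s \<le> (\<Sum>k\<in>K \<union> I. (\<beta> k)\<^sup>2)" .
    have s0: "0 \<le> ?s" by (intro sum_nonneg) auto
    \<comment> \<open>\<open>4 / 5\<close> is a convenient rational below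
      \<open>sqrt (3/4)\<close>.\<close>
    have "(4 / 5)\<^sup>2 * ?s \<le> 3 / 4 * ?s" using s0 by (intro mult_right_mono) (auto simp: power2_eq_square)
    then have "sqrt ((4 / 5)\<^sup>2 * ?s) \<le> sqrt (\<Sum>k\<in>K \<union> I. (\<beta> k)\<^sup>2)"
      using le by (intro real_sqrt_le_mono) linarith
    then have "4 / 5 * sqrt ?s \<le> sqrt (\<Sum>k\<in>K \<union> I. (\<beta> k)\<^sup>2)"
      by (simp add: real_sqrt_mult)
    then have "A * (4 / 5 * sqrt ?s) \<le> A * sqrt (\<Sum>k\<in>K \<union> I. (\<beta> k)\<^sup>2)"
      using A by (intro mult_left_mono) auto
    also have "\<dots> \<le> norm (u - z)"
      unfolding uz using K I by (intro riesz_lower_boundD[OF A(2)]) auto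
    finally have "C * (A * (4 / 5 * sqrt ?s)) \<le> C * norm (u - z)"
      using C by (intro mult_left_mono) auto
    moreover have "norm u \<le> C * A * sqrt ?s"
      unfolding u_def by (rule riesz_upper_boundD[OF A(3) K])
    ultimately have 1: "4 / 5 * norm u \<le> C * norm (u - z)" by (simp add: algebra_simps)
    have "C * norm (v - u) \<le> C * (\<epsilon> * norm v)"
      using vu C by (intro mult_left_mono) auto
    then have 2: "C * norm (v - u) \<le> 1 / 10 * norm v"
      using \<epsilon>(2) by (simp add: mult.assoc[symmetric])
    have "norm (u - z) \<le> norm (v - z) + norm (v - u)"
      using norm_triangle_ineq4[of "v - z" "v - u"] by simp
    then have 3: "C * norm (u - z) \<le> C * norm (v - z) + C * norm (v - u)"
      using C mult_left_mono[of "norm (u - z)" "norm (v - z) + norm (v - u)" C]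
      by (simp add: distrib_left)
    have "norm (v - u) \<le> 1 / 10 * norm v"
      using vu \<epsilon>(3) by (meson mult_right_mono norm_ge_zero order_trans)
    then have "9 / 10 * norm v \<le> norm u" using norm_triangle_ineq2[of v u] by linarith
    \<comment> \<open>The losses add up to \<open>4/5 * 9/10 - 1/10 = 0.62\<close>, which exceeds
      \<open>1/2\<close>.\<close>
    then have "norm v \<le> 2 * (C * norm (v - z))"
      using 1 2 3 norm_ge_zero[of v] by linarith
    then show ?thesis by (simp add: z_def mult.assoc)
  qed
  ultimately show thesis using that by blast
qed

section \<open>From the bad vector to the widths\<close>

text \<open>The chosen indices may repeat; the coefficients of equal indices are added up.\<close>

lemma nterm_combination_regroup:
  fixes c :: "'b \<Rightarrow> real" and h :: "'c \<Rightarrow> 'd::real_vector"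
  assumes "finite L"
  obtains t where "(\<Sum>k\<in>L. c k *\<^sub>R h (i k)) = (\<Sum>j\<in>i ` L. t j *\<^sub>R h j)"
proof
  show "(\<Sum>k\<in>L. c k *\<^sub>R h (i k)) = (\<Sum>j\<in>i ` L. (\<Sum>k | k \<in> L \<and> i k = j. c k) *\<^sub>R h j)"
    unfolding sum.image_gen[OF assms, of "\<lambda>k. c k *\<^sub>R h (i k)" i] scaleR_sum_left
    by (intro sum.cong) auto
qed

text \<open>The bad vector, scaled to norm \<open>r\<close>, lies in the ball and hence equals
  \<open>S f\<close> for some \<open>f\<close> in the unit ball of \<open>F\<close>; this
  \<open>f\<close> witnesses the error.\<close>

lemma worst_case_error_ge:
  fixes S :: "'g \<Rightarrow> 'h::real_inner"
  assumes h: "h \<in> riesz_bases C" and C: "1 \<le> C" and T: "T \<in> nterm_maps n F h"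
    and V: "subspace V" "dim V > 0" "4 * n \<le> dim V"
    and r: "0 \<le> r" and ball: "cball 0 r \<inter> V \<subseteq> S ` {f\<in>F. q f \<le> 1}"
  shows "ennreal (1 / (2 * C)) * ennreal r \<le> worst_case_error S F q T"
proof -
  obtain v where v: "v \<in> V" "v \<noteq> 0"
    "\<And>I t. finite I \<Longrightarrow> card I \<le> n \<Longrightarrow> norm v \<le> 2 * C * norm (v - (\<Sum>k\<in>I. t k *\<^sub>R h k))"
    using exists_badly_approximable[OF h C V] by metis
  define s where "s = norm v / r"
  show ?thesis
  proof (cases "r = 0")
    case False
    then have r: "r > 0" using r by simp
    have s: "s > 0" "s * r = norm v" using r v by (auto simp: s_def)
    have "(1 / s) *\<^sub>R v \<in> cball 0 r \<inter> V"
      using v V r s by (auto simp: subspace_scale s_def)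
    then obtain f where f: "f \<in> F" "q f \<le> 1" "S f = (1 / s) *\<^sub>R v" using ball by force
    obtain c i where "T f = (\<Sum>k=1..n. c k *\<^sub>R h (i k))"
      using T f by (auto simp: nterm_maps_def)
    then obtain t where t: "T f = (\<Sum>j\<in>i ` {1..n}. t j *\<^sub>R h j)"
      by (metis finite_atLeastAtMost nterm_combination_regroup)
    \<comment> \<open>Multiples of n-term combinations are again n-term combinations, so the bound
      on \<open>v\<close> applies to \<open>s *\<^sub>R T f\<close>.\<close>
    have sT: "s *\<^sub>R T f = (\<Sum>j\<in>i ` {1..n}. (s * t j) *\<^sub>R h j)"
      unfolding t by (simp add: scaleR_sum_right)
    have "card (i ` {1..n}) \<le> n" using card_image_le[of "{1..n}" i] by simp
    then have "s * r \<le> 2 * C * norm (v - s *\<^sub>R T f)"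
      unfolding sT s(2) by (intro v(3)) auto
    also have "v - s *\<^sub>R T f = s *\<^sub>R (S f - T f)" using s by (simp add: f(3) scaleR_diff_right)
    also have "2 * C * norm (s *\<^sub>R (S f - T f)) = s * (2 * C * norm (S f - T f))" using s by simp
    finally have "r \<le> 2 * C * norm (S f - T f)" using s mult_le_cancel_left_pos by blast
    then have "1 / (2 * C) * r \<le> norm (S f - T f)" using C by (simp add: field_simps)
    then have "ennreal (1 / (2 * C)) * ennreal r \<le> ennreal (norm (S f - T f))"
      using C r by (simp add: ennreal_mult[symmetric] ennreal_leI)
    also have "\<dots> \<le> worst_case_error S F q T"
      unfolding worst_case_error_def using f by (intro SUP_upper) auto
    finally show ?thesis .
  qed simp
qed

theorem theorem1:
  fixes \<A> :: "'h::{real_inner,complete_space} \<Rightarrow> 'g::{real_inner,complete_space}"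
    and F :: "'g set" and q :: "'g \<Rightarrow> real" and S :: "'g \<Rightarrow> 'h"
    and C :: real and n :: nat
  assumes "boundedly_invertible \<A>"
    and "subspace F"
    and "quasi_norm_on F q"
    and "\<And>f. f \<in> F \<Longrightarrow> S f = inv \<A> f"
    and "1 \<le> C"
  shows "\<forall>m::nat. real m \<ge> 4 * C\<^sup>2 * real n \<longrightarrow>
    nonlinear_width n C S F q \<ge> ennreal (1 / (2 * C)) * bernstein_width m S F q"
proof (intro allI impI)
  fix m :: nat
  assume "real m \<ge> 4 * C\<^sup>2 * real n"
  moreover have "4 * 1 * real n \<le> 4 * C\<^sup>2 * real n"
    using \<open>1 \<le> C\<close> by (intro mult_right_mono mult_left_mono) auto
  \<comment> \<open>Subspaces of dimension \<open>m + 1\<close> are thus large enough for the flat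
    vector argument.\<close>
  ultimately have m: "4 * n \<le> m + 1" by linarith
  define R where "R = {ennreal r | r V. 0 \<le> r \<and> subspace V \<and> dim V = m + 1 \<and>
    cball 0 r \<inter> V \<subseteq> S ` {f\<in>F. q f \<le> 1}}"
  \<comment> \<open>With the factor inside the supremum, it remains to compare one ball with one
    basis and one n-term map.\<close>
  have "ennreal (1 / (2 * C)) * bernstein_width m S F q = (SUP x\<in>R. ennreal (1 / (2 * C)) * x)"
    unfolding bernstein_width_def R_def[symmetric]
    using SUP_mult_left_ennreal[of _ "\<lambda>x. x" R] by simp
  also have "\<dots> \<le> nonlinear_width n C S F q"
    unfolding nonlinear_width_def
  proof (intro SUP_least INF_greatest)
    fix x and h :: "nat \<Rightarrow> 'h" and T :: "'g \<Rightarrow> 'h"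
    assume x: "x \<in> R" and h: "h \<in> riesz_bases C" and T: "T \<in> nterm_maps n F h"
    from x obtain r V where "x = ennreal r" "0 \<le> r" "subspace V" "dim V = m + 1"
      "cball 0 r \<inter> V \<subseteq> S ` {f\<in>F. q f \<le> 1}"
      unfolding R_def by blast
    then show "ennreal (1 / (2 * C)) * x \<le> worst_case_error S F q T"
      using worst_case_error_ge[OF h \<open>1 \<le> C\<close> T] m by auto
  qed
  finally show "nonlinear_width n C S F q \<ge> ennreal (1 / (2 * C)) * bernstein_width m S F q" .
qed

end
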